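(* Let $f:\mathbb{R}\to\mathbb{R}$ be a twice differentiable function such that $f''$ is continuous, nonnegative, and has finitely many zeros in $\mathbb{R}$. Assume also that there exist $T>0$ and $m>0$ such that $f''(x)\geq m$ for all $x$ with $|x|>T$. Let $P=(s,t)$ be a point in the plane with $t<f(s)$. Then there are exactly two distinct tangent lines to the graph of $f$ which pass through $P$.
   Context: The tangent line to the graph of $f$ at $(c,f(c))$ is the line $y=T_c(x)$, where $T_c(x)=f(c)+f'(c)(x-c)$. It passes through $P=(s,t)$ if $T_c(s)=t$. Tangent lines are counted as distinct lines: a line which is tangent to the graph at more than one point is counted once. *)

theory Defs
  imports "HOL-Analysis.Analysis"
begin

definition tangent_map :: "(real \<Rightarrow> real) \<Rightarrow> real \<Rightarrow> real \<Rightarrow> real" where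
  "tangent_map f c x = f c + deriv f c * (x - c)"

(* A tangent line is a set of points of the plane, so that points of tangency
   sharing the same tangent give the same object. *)
definition tangent_line :: "(real \<Rightarrow> real) \<Rightarrow> real \<Rightarrow> (real \<times> real) set" where
  "tangent_line f c = {(x, y). y = tangent_map f c x}"

definition tangent_lines_through :: "(real \<Rightarrow> real) \<Rightarrow> real \<times> real \<Rightarrow> (real \<times> real) set set" where
  "tangent_lines_through f P = {L \<in> range (tangent_line f). P \<in> L}"

end

theory Submission
  imports Defs
begin

text \<open>
  Fix \<open>s\<close> and let the point of tangency \<open>c\<close> vary: the tangent at \<open>c\<close> meets the vertical line
  \<open>x = s\<close> at height \<open>h c = f c + f' c * (s - c)\<close>, and it passes through \<open>(s, t)\<close> iff \<open>h c = t\<close>.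
  Formally \<open>h' c = f'' c * (s - c)\<close>, so \<open>h\<close> should rise up to \<open>c = s\<close>, where it takes the value
  \<open>f s > t\<close>, and fall afterwards. Hence \<open>h\<close> takes the value \<open>t\<close> once on each side of \<open>s\<close>, provided that
  it drops below \<open>t\<close> on both sides; the lower bound \<open>m\<close> on \<open>f''\<close> far out guarantees this.

  Instead of differentiating \<open>h\<close>, everything is read off the identity \<open>tangent_height_diff\<close>,
  which splits \<open>h b - h a\<close> into the gap between the graph and a tangent and the term
  \<open>(f' b - f' a) * (s - b)\<close>. If \<open>b\<close> lies between \<open>a\<close> and \<open>s\<close>, both are nonnegative because \<open>f'\<close>
  increases; the first is positive, which gives strict monotonicity
  (\<open>tangent_height_strict\<close>), and the second grows at least linearly as \<open>a\<close> moves away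
  (\<open>tangent_height_drop\<close>).

  Finitely many zeros of \<open>f''\<close> make \<open>f'\<close> strictly increasing, so different points of tangency
  have tangents of different slopes, and counting lines amounts to counting solutions of
  \<open>h c = t\<close>.
\<close>

text \<open>
  A monotone function with equal values at two points is constant in between, where its derivative
  would then vanish infinitely often.
\<close>

lemma strict_mono_if_deriv_finite_zeros:
  fixes g :: "real \<Rightarrow> real"
  assumes diff: "\<And>x. g differentiable (at x)"
    and nonneg: "\<And>x. deriv g x \<ge> 0"
    and fin: "finite {x. deriv g x = 0}"
  shows "strict_mono g"
proof (rule strict_monoI)
  have DERIV: "(g has_real_derivative deriv g x) (at x)" for x
    using diff DERIV_deriv_iff_real_differentiable by blast
  have mono: "g x \<le> g y" if "x \<le> y" for x y
    using that DERIV nonneg by (intro DERIV_nonneg_imp_nondecreasing[of x y g]) blast+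
  fix a b :: real
  assume "a < b"
  show "g a < g b"
  proof (rule ccontr)
    assume "\<not> g a < g b"
    then have const: "g x = g a" if "x \<in> {a<..<b}" for x
      using mono[of a x] mono[of x b] that by auto
    have "deriv g x = 0" if "x \<in> {a<..<b}" for x
    proof -
      have "((\<lambda>_. g a) has_real_derivative deriv g x) (at x)"
        by (rule has_field_derivative_transform_within_open[OF DERIV[of x] open_greaterThanLessThan that])
          (use const in auto)
      then show ?thesis
        using DERIV_unique[OF _ DERIV_const] by blast
    qed
    then have "finite {a<..<b}"
      by (intro finite_subset[OF _ fin]) auto
    then show False
      using \<open>a < b\<close> infinite_Ioo by blast
  qed
qed

lemma tangent_below_graph:
  assumes diff: "\<And>x. f differentiable (at x)"
    and mono: "strict_mono (deriv f)"
    and "a \<noteq> b"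
  shows "tangent_map f a b < f b"
proof -
  have DERIV: "(f has_real_derivative deriv f x) (at x)" for x
    using diff DERIV_deriv_iff_real_differentiable by blast
  consider "a < b" | "b < a"
    using \<open>a \<noteq> b\<close> by linarith
  then show ?thesis
  proof cases
    case 1
    then obtain z where z: "a < z" "f b - f a = (b - a) * deriv f z"
      using MVT2[of a b f "deriv f"] DERIV by blast
    then have "(b - a) * deriv f a < (b - a) * deriv f z"
      using 1 mono by (simp add: strict_mono_less)
    then show ?thesis
      using z(2) by (simp add: tangent_map_def algebra_simps)
  next
    case 2
    then obtain z where z: "z < a" "f a - f b = (a - b) * deriv f z"
      using MVT2[of b a f "deriv f"] DERIV by blast
    then have "(a - b) * deriv f z < (a - b) * deriv f a"
      using 2 mono by (simp add: strict_mono_less)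
    then show ?thesis
      using z(2) by (simp add: tangent_map_def algebra_simps)
  qed
qed

text \<open>
  The tangents at \<open>a\<close> and \<open>b\<close> are compared first at \<open>b\<close>, where the second one touches the graph,
  and then carried over to \<open>s\<close> at their respective slopes.
\<close>

lemma tangent_height_diff:
  "tangent_map f b s - tangent_map f a s
    = (f b - tangent_map f a b) + (deriv f b - deriv f a) * (s - b)"
  by (simp add: tangent_map_def algebra_simps)

text \<open>
  Moving the point of tangency away from \<open>s\<close>, in either direction, lowers the tangent over \<open>s\<close>.
\<close>

lemma tangent_height_strict:
  assumes diff: "\<And>x. f differentiable (at x)"
    and mono: "strict_mono (deriv f)"
    and between: "a < b \<and> b \<le> s \<or> s \<le> b \<and> b < a"
  shows "tangent_map f a s < tangent_map f b s"
proof -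
  have "(deriv f b - deriv f a) * (s - b) \<ge> 0"
    using between strict_mono_less[OF mono, of a b] strict_mono_less[OF mono, of b a]
    by (auto intro: mult_nonneg_nonneg mult_nonpos_nonpos)
  moreover have "tangent_map f a b < f b"
    using between by (intro tangent_below_graph[OF diff mono]) auto
  ultimately show ?thesis
    using tangent_height_diff[of f b s a] by linarith
qed

text \<open>
  The hypothesis \<open>slope\<close> is the bound \<open>f'' \<ge> m\<close> between \<open>a\<close> and \<open>b\<close> in integrated form, written with
  absolute values so that one statement serves both sides of \<open>s\<close>.
\<close>

lemma tangent_height_drop:
  assumes diff: "\<And>x. f differentiable (at x)"
    and mono: "strict_mono (deriv f)"
    and between: "a < b \<and> b \<le> s \<or> s \<le> b \<and> b < a"
    and slope: "m * \<bar>b - a\<bar> \<le> \<bar>deriv f b - deriv f a\<bar>"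
  shows "tangent_map f a s \<le> tangent_map f b s - m * \<bar>b - a\<bar> * \<bar>s - b\<bar>"
proof -
  have "m * \<bar>b - a\<bar> * \<bar>s - b\<bar> \<le> \<bar>deriv f b - deriv f a\<bar> * \<bar>s - b\<bar>"
    using slope by (intro mult_right_mono) auto
  also have "\<dots> = (deriv f b - deriv f a) * (s - b)"
    using between strict_mono_less[OF mono, of a b] strict_mono_less[OF mono, of b a]
    by (auto simp: algebra_simps)
  finally have "m * \<bar>b - a\<bar> * \<bar>s - b\<bar> \<le> (deriv f b - deriv f a) * (s - b)" .
  moreover have "tangent_map f a b < f b"
    using between by (intro tangent_below_graph[OF diff mono]) auto
  ultimately show ?thesis
    using tangent_height_diff[of f b s a] by linarith
qed

lemma slope_increment_ge:
  fixes g :: "real \<Rightarrow> real"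
  assumes diff: "\<And>x. g differentiable (at x)"
    and "a < b"
    and lower: "\<And>x. a < x \<Longrightarrow> x < b \<Longrightarrow> deriv g x \<ge> m"
  shows "m * (b - a) \<le> g b - g a"
proof -
  have DERIV: "(g has_real_derivative deriv g x) (at x)" for x
    using diff DERIV_deriv_iff_real_differentiable by blast
  obtain z where z: "a < z" "z < b" "g b - g a = (b - a) * deriv g z"
    using MVT2[OF \<open>a < b\<close>, of g "deriv g"] DERIV by blast
  then show ?thesis
    using lower[OF z(1,2)] \<open>a < b\<close> by (simp add: mult.commute[of m])
qed

text \<open>
  On either side of \<open>s\<close>, start at a point \<open>b\<close> at distance at least \<open>1\<close> from \<open>s\<close> and outside
  \<open>(-T, T)\<close>. From there on outwards the slope of the
  tangents changes at rate at least \<open>m\<close> and acts over a horizontal distance of at least \<open>1\<close>, so the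
  height over \<open>s\<close> falls at rate at least \<open>m\<close> and any level \<open>t\<close> is passed.
\<close>

lemma tangent_height_unbounded_below:
  assumes diff: "\<And>x. f differentiable (at x)"
    and diff': "\<And>x. deriv f differentiable (at x)"
    and mono: "strict_mono (deriv f)"
    and "m > 0"
    and far: "\<And>x. \<bar>x\<bar> > T \<Longrightarrow> deriv (deriv f) x \<ge> m"
  shows "\<exists>c<s. tangent_map f c s \<le> t" and "\<exists>c>s. tangent_map f c s \<le> t"
proof -
  have reach: "tangent_map f a s \<le> t"
    if between: "a < b \<and> b \<le> s \<or> s \<le> b \<and> b < a" and "\<bar>s - b\<bar> \<ge> 1"
      and slope: "m * \<bar>b - a\<bar> \<le> \<bar>deriv f b - deriv f a\<bar>"
      and dist: "\<bar>b - a\<bar> \<ge> (tangent_map f b s - t) / m" for a b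
  proof -
    have "tangent_map f b s - t \<le> m * \<bar>b - a\<bar>"
      using dist \<open>m > 0\<close> by (simp add: field_simps)
    also have "\<dots> \<le> m * \<bar>b - a\<bar> * \<bar>s - b\<bar>"
      using \<open>\<bar>s - b\<bar> \<ge> 1\<close> \<open>m > 0\<close> mult_left_mono[of 1 "\<bar>s - b\<bar>" "m * \<bar>b - a\<bar>"] by simp
    finally show ?thesis
      using tangent_height_drop[OF diff mono between slope] by linarith
  qed
  show "\<exists>c<s. tangent_map f c s \<le> t"
  proof -
    define b where "b = min (s - 1) (- T)"
    \<comment> \<open>The \<open>max 1\<close> keeps \<open>a\<close> away from \<open>b\<close> when the height at \<open>b\<close> is already at most \<open>t\<close>.\<close>
    define a where "a = b - max 1 ((tangent_map f b s - t) / m)"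
    have "a < b" "b \<le> s - 1" "b \<le> - T"
      by (auto simp: a_def b_def)
    have "m * (b - a) \<le> deriv f b - deriv f a"
      using \<open>b \<le> - T\<close> by (intro slope_increment_ge[OF diff' \<open>a < b\<close>] far) auto
    then have "tangent_map f a s \<le> t"
      using \<open>a < b\<close> \<open>b \<le> s - 1\<close> by (intro reach[of a b]) (auto simp: a_def)
    then show ?thesis
      using \<open>a < b\<close> \<open>b \<le> s - 1\<close> by (intro exI[of _ a]) auto
  qed
  show "\<exists>c>s. tangent_map f c s \<le> t"
  proof -
    define b where "b = max (s + 1) T"
    define a where "a = b + max 1 ((tangent_map f b s - t) / m)"
    have "b < a" "s + 1 \<le> b" "T \<le> b"
      by (auto simp: a_def b_def)
    have "m * (a - b) \<le> deriv f a - deriv f b"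
      using \<open>T \<le> b\<close> by (intro slope_increment_ge[OF diff' \<open>b < a\<close>] far) auto
    then have "tangent_map f a s \<le> t"
      using \<open>b < a\<close> \<open>s + 1 \<le> b\<close> by (intro reach[of a b]) (auto simp: a_def)
    then show ?thesis
      using \<open>b < a\<close> \<open>s + 1 \<le> b\<close> by (intro exI[of _ a]) auto
  qed
qed

text \<open>
  A tangent line, as a set of points, determines its slope and hence, by injectivity of \<open>f'\<close>,
  its point of tangency.
\<close>

lemma inj_tangent_line:
  assumes mono: "strict_mono (deriv f)"
  shows "inj (tangent_line f)"
proof (rule injI)
  fix a b
  assume eq: "tangent_line f a = tangent_line f b"
  have "tangent_map f a x = tangent_map f b x" for x
  proof -
    have "(x, tangent_map f a x) \<in> tangent_line f b"
      unfolding eq[symmetric] by (simp add: tangent_line_def)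
    then show ?thesis
      by (simp add: tangent_line_def)
  qed
  from this[of 0] this[of 1] have "deriv f a = deriv f b"
    by (simp add: tangent_map_def algebra_simps)
  then show "a = b"
    using strict_mono_eq[OF mono] by blast
qed

lemma tangent_lines_through_eq_image:
  "tangent_lines_through f (s, t) = tangent_line f ` {c. tangent_map f c s = t}"
  by (auto simp: tangent_lines_through_def tangent_line_def)

theorem theorem1:
  fixes f :: "real \<Rightarrow> real" and T m s t :: real
  assumes "\<And>x. f differentiable (at x)"
    and "\<And>x. deriv f differentiable (at x)"
    and "continuous_on UNIV (deriv (deriv f))"
    and "\<And>x. deriv (deriv f) x \<ge> 0"
    and "finite {x. deriv (deriv f) x = 0}"
    and "T > 0" and "m > 0"
    and "\<And>x. \<bar>x\<bar> > T \<Longrightarrow> deriv (deriv f) x \<ge> m"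
    and "t < f s"
  shows "card (tangent_lines_through f (s, t)) = 2"
proof -
  let ?h = "\<lambda>c. tangent_map f c s"
  have mono: "strict_mono (deriv f)"
    by (rule strict_mono_if_deriv_finite_zeros[OF assms(2,4,5)])
  have strict: "?h a < ?h b" if "a < b \<and> b \<le> s \<or> s \<le> b \<and> b < a" for a b
    by (rule tangent_height_strict[OF assms(1) mono that])
  have cont: "continuous_on A ?h" for A
  proof -
    have "continuous_on A f" "continuous_on A (deriv f)"
      using assms(1,2) by (auto intro!: continuous_at_imp_continuous_on differentiable_imp_continuous_within)
    then show ?thesis
      unfolding tangent_map_def by (intro continuous_intros)
  qed
  have top: "t < ?h s"
    using \<open>t < f s\<close> by (simp add: tangent_map_def)
  obtain l where "l < s" "?h l \<le> t"
    using tangent_height_unbounded_below(1)[OF assms(1,2) mono assms(7,8)] by blast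
  then obtain c1 where c1: "c1 \<le> s" "?h c1 = t"
    using IVT'[of ?h l t s] cont top by fastforce
  obtain r where "s < r" "?h r \<le> t"
    using tangent_height_unbounded_below(2)[OF assms(1,2) mono assms(7,8)] by blast
  then obtain c2 where c2: "s \<le> c2" "?h c2 = t"
    using IVT2'[of ?h r t s] cont top by fastforce
  have "c = c1 \<or> c = c2" if "?h c = t" for c
    using strict[of c c1] strict[of c1 c] strict[of c c2] strict[of c2 c] c1 c2 that by linarith
  then have "{c. ?h c = t} = {c1, c2}"
    using c1 c2 by blast
  moreover have "c1 \<noteq> c2"
    using c1 c2 top by force
  ultimately show ?thesis
    using inj_tangent_line[OF mono]
    by (simp add: tangent_lines_through_eq_image card_image inj_on_subset[OF _ subset_UNIV] inj_eq)
qed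

end
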